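(* Let $A=[\mathbf{a}_1,\dots,\mathbf{a}_n]\in\mathbb{Z}^{m\times n}$ be an integer matrix with bouquets $B_1,\dots,B_s$, and let $A_B=[\mathbf{a}_{B_1},\dots,\mathbf{a}_{B_s}]$ be its bouquet matrix. For $\mathbf{u}=(u_1,\dots,u_s)\in\operatorname{Ker}_{\mathbb{Z}}(A_B)$ put $$B(\mathbf{u}):=\mathbf{c}_{B_1}u_1+\cdots+\mathbf{c}_{B_s}u_s .$$ Then $\mathbf{u}\mapsto B(\mathbf{u})$ is a bijection from $\operatorname{Ker}_{\mathbb{Z}}(A_B)$ onto $\operatorname{Ker}_{\mathbb{Z}}(A)$. Moreover, it restricts to a bijection between the Graver bases and to a bijection between the sets of circuits: $$\mathcal{G}r(A)=\{B(\mathbf{u}) : \mathbf{u}\in\mathcal{G}r(A_B)\},\qquad \mathcal{C}(A)=\{B(\mathbf{u}) : \mathbf{u}\in\mathcal{C}(A_B)\}.$$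
   Context: For an integer matrix $A=[\mathbf{a}_1,\dots,\mathbf{a}_n]\in\mathbb{Z}^{m\times n}$ let $\operatorname{Ker}_{\mathbb{Z}}(A)=\{\mathbf{u}\in\mathbb{Z}^n: A\mathbf{u}=\mathbf{0}\}$. The support of a vector is its set of nonzero coordinates. Gale transform: let $r=\operatorname{rank}A$, fix a basis $G_1,\dots,G_{n-r}$ of the lattice $\operatorname{Ker}_{\mathbb{Z}}(A)$, and let $G(\mathbf{a}_i)\in\mathbb{Z}^{n-r}$ be the $i$-th row of the $n\times(n-r)$ matrix with columns $G_1,\dots,G_{n-r}$. Bouquets: a co-vector of $A$ is a vector $(\mathbf{v}\cdot\mathbf{a}_1,\dots,\mathbf{v}\cdot\mathbf{a}_n)$ with $\mathbf{v}\in\mathbb{Z}^m$; a co-circuit is a nonzero co-vector of minimal support. $\mathbf{a}_i$ is free if $\{i\}$ is the support of a co-circuit (equivalently $G(\mathbf{a}_i)=\mathbf{0}$). The bouquet graph $G_A$ has vertices $\mathbf{a}_1,\dots,\mathbf{a}_n$ (distinguished by their indices), and $\{\mathbf{a}_i,\mathbf{a}_j\}$, $i\ne j$, is an edge if there is a co-vector with support $\{i,j\}$. The bouquets of $A$ are the connected components of $G_A$. If there are free vectors, they form one bouquet, called the free bouquet; every other bouquet is non-free. Vectors $\mathbf{c}_B$ and $\mathbf{a}_B$: if $B$ is free, $\mathbf{c}_B\in\mathbb{Z}^n$ is any (fixed) vector with support $\{i:\mathbf{a}_i\in B\}$ and positive first nonzero coordinate. If $B$ is non-free, the vectors $G(\mathbf{a}_i)$,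 $\mathbf{a}_i\in B$, are nonzero and pairwise linearly dependent; choose a coordinate $j$ in which they are all nonzero, let $g_j=\gcd(G(\mathbf{a}_i)_j:\mathbf{a}_i\in B)$, let $i_0$ be the smallest index with $\mathbf{a}_{i_0}\in B$, let $\varepsilon$ be the sign of $G(\mathbf{a}_{i_0})_j$, and let $\mathbf{c}_B\in\mathbb{Z}^n$ have $i$-th coordinate $\varepsilon G(\mathbf{a}_i)_j/g_j$ if $\mathbf{a}_i\in B$ and $0$ otherwise (this is independent of $j$). Set $\mathbf{a}_B=\sum_{i=1}^n(\mathbf{c}_B)_i\mathbf{a}_i\in\mathbb{Z}^m$. Graver basis and circuits: a decomposition $\mathbf{u}=\mathbf{v}+\mathbf{w}$ with $\mathbf{u},\mathbf{v},\mathbf{w}\in\operatorname{Ker}_{\mathbb{Z}}(A)$ is conformal if $\mathbf{u}^+=\mathbf{v}^++\mathbf{w}^+$ and $\mathbf{u}^-=\mathbf{v}^-+\mathbf{w}^-$ (where $\mathbf{u}=\mathbf{u}^+-\mathbf{u}^-$ with $\mathbf{u}^{\pm}$ nonnegative of disjoint support), and proper if $\mathbf{v},\mathbf{w}\neq\mathbf{0}$. $\mathcal{G}r(A)$ is the set of nonzero vectors of $\operatorname{Ker}_{\mathbb{Z}}(A)$ having no proper conformal decomposition. $\mathcal{C}(A)$ is the set of nonzero vectors of $\operatorname{Ker}_{\mathbb{Z}}(A)$ with inclusion-minimal support and relatively prime coordinates. *)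

theory Defs
  imports "Jordan_Normal_Form.Matrix_Kernel" "Jordan_Normal_Form.DL_Rank"
begin

text \<open>Indices are 0-based: the columns \<open>col A i\<close> of an \<open>m \<times> n\<close> matrix, \<open>i < n\<close>, are identified
  with their indices, so sets of columns are sets of natural numbers.  The lattice
  \<open>Ker\<^sub>\<int>(A)\<close> of an integer matrix is \<open>mat_kernel A\<close>.\<close>

definition vec_support :: "int vec \<Rightarrow> nat set" where
  "vec_support u = {i. i < dim_vec u \<and> u $ i \<noteq> 0}"

subsection \<open>Gale transforms\<close>

definition int_rank :: "int mat \<Rightarrow> nat" where
  "int_rank A = vec_space.rank (dim_row A) (map_mat rat_of_int A)"

text \<open>The columns of \<open>G\<close> are a basis of the lattice \<open>mat_kernel A\<close>: integer combinations \<open>G *\<^sub>v x\<close>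
  of the columns represent each kernel element exactly once.  The Gale vector of column \<open>i\<close> of \<open>A\<close>
  is \<open>row G i\<close>.\<close>

definition is_gale_matrix :: "int mat \<Rightarrow> int mat \<Rightarrow> bool" where
  "is_gale_matrix A G \<longleftrightarrow>
     G \<in> carrier_mat (dim_col A) (dim_col A - int_rank A) \<and>
     bij_betw (\<lambda>x. G *\<^sub>v x) (carrier_vec (dim_col A - int_rank A)) (mat_kernel A)"

subsection \<open>Bouquets\<close>

definition covectors :: "int mat \<Rightarrow> int vec set" where
  "covectors A = {vec (dim_col A) (\<lambda>i. v \<bullet> col A i) | v. v \<in> carrier_vec (dim_row A)}"

definition cocircuits :: "int mat \<Rightarrow> int vec set" where
  "cocircuits A = {c \<in> covectors A. c \<noteq> 0\<^sub>v (dim_col A) \<and>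
     \<not> (\<exists>c' \<in> covectors A. c' \<noteq> 0\<^sub>v (dim_col A) \<and> vec_support c' \<subset> vec_support c)}"

definition free_indices :: "int mat \<Rightarrow> nat set" where
  "free_indices A = {i. i < dim_col A \<and> (\<exists>c \<in> cocircuits A. vec_support c = {i})}"

definition bouquet_edges :: "int mat \<Rightarrow> (nat \<times> nat) set" where
  "bouquet_edges A = {(i, j). i < dim_col A \<and> j < dim_col A \<and> i \<noteq> j \<and>
     (\<exists>c \<in> covectors A. vec_support c = {i, j})}"

text \<open>Connected components of the (symmetric) edge relation.\<close>

definition bouquets :: "int mat \<Rightarrow> nat set set" where
  "bouquets A = {..<dim_col A} // ((bouquet_edges A)\<^sup>* \<inter> {..<dim_col A} \<times> {..<dim_col A})"

text \<open>Admissible choices of the vector attached to the free bouquet.\<close>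

definition is_free_vec :: "int mat \<Rightarrow> int vec \<Rightarrow> bool" where
  "is_free_vec A f \<longleftrightarrow>
     f \<in> carrier_vec (dim_col A) \<and> vec_support f = free_indices A \<and> f $ Min (vec_support f) > 0"

text \<open>The vector \<open>c\<^sub>B\<close>, relative to a Gale matrix \<open>G\<close> and a vector \<open>f\<close> chosen for the free bouquet.
  For a non-free bouquet, \<open>j\<close> is any coordinate in which all Gale vectors of \<open>B\<close> are nonzero;
  the division is exact.\<close>

definition bouquet_vec :: "int mat \<Rightarrow> int mat \<Rightarrow> int vec \<Rightarrow> nat set \<Rightarrow> int vec" where
  "bouquet_vec A G f B =
     (if B = free_indices A then f
      else let j = (SOME j. j < dim_col G \<and> (\<forall>i\<in>B. G $$ (i, j) \<noteq> 0));
               g = Gcd ((\<lambda>i. G $$ (i, j)) ` B);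
               \<epsilon> = sgn (G $$ (Min B, j))
           in vec (dim_col A) (\<lambda>i. if i \<in> B then (\<epsilon> * G $$ (i, j)) div g else 0))"

text \<open>The bouquet matrix, for an enumeration \<open>Bs\<close> of the bouquets: its columns are
  \<open>a\<^sub>B = \<Sum>\<^sub>i (c\<^sub>B)\<^sub>i a\<^sub>i = A *\<^sub>v c\<^sub>B\<close>.\<close>

definition bouquet_mat :: "int mat \<Rightarrow> int mat \<Rightarrow> int vec \<Rightarrow> nat set list \<Rightarrow> int mat" where
  "bouquet_mat A G f Bs = mat_of_cols (dim_row A) (map (\<lambda>B. A *\<^sub>v bouquet_vec A G f B) Bs)"

definition bouquet_map ::
  "int mat \<Rightarrow> int mat \<Rightarrow> int vec \<Rightarrow> nat set list \<Rightarrow> int vec \<Rightarrow> int vec" where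
  "bouquet_map A G f Bs u =
     vec (dim_col A) (\<lambda>i. \<Sum>k<length Bs. bouquet_vec A G f (Bs ! k) $ i * u $ k)"

subsection \<open>Graver basis and circuits\<close>

definition pos_vec :: "int vec \<Rightarrow> int vec" where
  "pos_vec u = map_vec (\<lambda>x. max x 0) u"

definition neg_vec :: "int vec \<Rightarrow> int vec" where
  "neg_vec u = map_vec (\<lambda>x. max (- x) 0) u"

definition conformal_decomp :: "int vec \<Rightarrow> int vec \<Rightarrow> int vec \<Rightarrow> bool" where
  "conformal_decomp u v w \<longleftrightarrow>
     u = v + w \<and> pos_vec u = pos_vec v + pos_vec w \<and> neg_vec u = neg_vec v + neg_vec w"

definition graver_basis :: "int mat \<Rightarrow> int vec set" where
  "graver_basis A = {u \<in> mat_kernel A. u \<noteq> 0\<^sub>v (dim_col A) \<and>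
     \<not> (\<exists>v \<in> mat_kernel A. \<exists>w \<in> mat_kernel A.
          v \<noteq> 0\<^sub>v (dim_col A) \<and> w \<noteq> 0\<^sub>v (dim_col A) \<and> conformal_decomp u v w)}"

definition matrix_circuits :: "int mat \<Rightarrow> int vec set" where
  "matrix_circuits A = {u \<in> mat_kernel A. u \<noteq> 0\<^sub>v (dim_col A) \<and>
     \<not> (\<exists>v \<in> mat_kernel A. v \<noteq> 0\<^sub>v (dim_col A) \<and> vec_support v \<subset> vec_support u) \<and>
     Gcd (set\<^sub>v u) = 1}"

end

theory Submission
  imports Defs
begin

text \<open>Let \<open>C\<close> be the matrix with columns \<open>c\<^sub>B\<close>.  Then the bouquet map is \<open>u \<mapsto> C *\<^sub>v u\<close> and the
  bouquet matrix is \<open>A * C\<close>, so \<open>u\<close> lies in the kernel of \<open>A * C\<close> exactly when \<open>C *\<^sub>v u\<close> lies in the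
  kernel of \<open>A\<close>.  The bouquets partition the column indices and \<open>c\<^sub>B\<close> has support \<open>B\<close>, so each row
  of \<open>C\<close> has a single nonzero entry: the coordinate of \<open>C *\<^sub>v u\<close> at \<open>i \<in> B\<close> is the coordinate of \<open>u\<close>
  at \<open>B\<close> times the nonzero number \<open>(c\<^sub>B)\<^sub>i\<close>.  This gives injectivity, and it shows that conformality
  and inclusion of supports are the same for \<open>u\<close> as for \<open>C *\<^sub>v u\<close>.

  What remains is surjectivity and the invariance of the gcd of the coordinates, and both can be
  checked on one bouquet at a time.  On the free bouquet every kernel element of \<open>A\<close>
  vanishes.  On any other bouquet \<open>B\<close>, an edge is a co-vector with two nonzero entries; it is
  orthogonal to the kernel, so the two corresponding coordinates of kernel elements are
  proportional, with a ratio that does not depend on the element.  This propagates along paths, so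
  every kernel element restricted to \<open>B\<close> is a rational multiple of \<open>c\<^sub>B\<close>; the entries of \<open>c\<^sub>B\<close> have
  gcd 1, so the multiple is an integer, and the multiple has the same content as the restriction.

  The definition of \<open>c\<^sub>B\<close> for non-free \<open>B\<close> needs a kernel element (a column of the Gale matrix)
  that is nonzero on \<open>B\<close>.  Its existence is duality: an index where the whole integer kernel vanishes
  supports a co-circuit (\<open>free_indices_iff_kernel_vanishes\<close>), which rests on a Fredholm
  alternative over the integers.  The argument on blocks is carried out in the locale
  \<open>bouquet_lift\<close>, which forgets where the columns of \<open>C\<close> came from.\<close>

section \<open>Co-vectors and the integer kernel\<close>

text \<open>Double orthogonality without denominators: either a nonzero multiple of \<open>b\<close> is an integer
  combination of the rows \<open>a k\<close>, or some integer vector orthogonal to all rows is not orthogonal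
  to \<open>b\<close>.  The induction adds one row \<open>a m\<close>.  If the vector \<open>u\<close> obtained for the earlier rows is not
  orthogonal to \<open>a m\<close>, it serves as a pivot: \<open>b\<close> is moved along \<open>a m\<close> into the hyperplane
  orthogonal to \<open>u\<close>, and the hypothesis is used once more for the moved vector.\<close>

lemma fredholm_alternative_int:
  fixes a :: "nat \<Rightarrow> nat \<Rightarrow> int" and b :: "nat \<Rightarrow> int" and m n :: nat
  shows "(\<exists>c v. c \<noteq> 0 \<and> (\<forall>i<n. c * b i = (\<Sum>k<m. v k * a k i))) \<or>
    (\<exists>u. (\<forall>k<m. (\<Sum>i<n. u i * a k i) = 0) \<and> (\<Sum>i<n. u i * b i) \<noteq> 0)"
proof (induction m arbitrary: b)
  case 0
  show ?case
  proof (cases "\<forall>i<n. b i = 0")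
    case True
    then show ?thesis by (intro disjI1 exI[of _ 1]) simp
  next
    case False
    then obtain j where "j < n" "b j \<noteq> 0" by blast
    then have "(\<Sum>i<n. (if i = j then 1 else 0) * b i) \<noteq> 0"
      by (simp add: if_distrib[of "\<lambda>x. x * _"] cong: if_cong)
    then show ?thesis by (intro disjI2 exI[of _ "\<lambda>i. if i = j then 1 else 0"]) simp
  qed
next
  case (Suc m)
  define dot where "dot x y = (\<Sum>i<n. x i * y i)" for x y :: "nat \<Rightarrow> int"
  have dot_comb: "dot x (\<lambda>i. p * y i - q * z i) = p * dot x y - q * dot x z"
    "dot (\<lambda>i. p * y i - q * z i) x = p * dot y x - q * dot z x" for x y z p q
    by (simp_all add: dot_def sum_distrib_left sum_subtractf[symmetric] algebra_simps)
  show ?case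
  proof (cases "\<exists>c v. c \<noteq> 0 \<and> (\<forall>i<n. c * b i = (\<Sum>k<m. v k * a k i))")
    case True
    then obtain c v where cv: "c \<noteq> 0" "\<forall>i<n. c * b i = (\<Sum>k<m. v k * a k i)" by blast
    then have "\<forall>i<n. c * b i = (\<Sum>k<Suc m. (v(m := 0)) k * a k i)" by simp
    with cv(1) show ?thesis by blast
  next
    case False
    with Suc.IH[of b] obtain u where u: "\<forall>k<m. dot u (a k) = 0" "dot u b \<noteq> 0"
      unfolding dot_def by blast
    show ?thesis
    proof (cases "dot u (a m) = 0")
      case True
      with u show ?thesis unfolding dot_def less_Suc_eq by blast
    next
      case um: False
      let ?\<alpha> = "dot u (a m)" and ?\<beta> = "dot u b"
      \<comment> \<open>the projection of \<open>b\<close> along \<open>a m\<close> onto the hyperplane orthogonal to \<open>u\<close>, scaled by \<open>?\<alpha>\<close>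
        to stay integral\<close>
      define b' where "b' i = ?\<alpha> * b i - ?\<beta> * a m i" for i
      from Suc.IH[of b'] show ?thesis
      proof
        assume "\<exists>c v. c \<noteq> 0 \<and> (\<forall>i<n. c * b' i = (\<Sum>k<m. v k * a k i))"
        then obtain c v where cv: "c \<noteq> 0" "\<forall>i<n. c * b' i = (\<Sum>k<m. v k * a k i)" by blast
        have "(c * ?\<alpha>) * b i = (\<Sum>k<Suc m. (v(m := c * ?\<beta>)) k * a k i)" if "i < n" for i
        proof -
          have "(\<Sum>k<m. v k * a k i) = c * b' i" using cv(2) that by simp
          then show ?thesis by (simp add: b'_def algebra_simps)
        qed
        moreover have "c * ?\<alpha> \<noteq> 0" using cv(1) um by simp
        ultimately show ?thesis by blast
      next
        assume "\<exists>u'. (\<forall>k<m. (\<Sum>i<n. u' i * a k i) = 0) \<and> (\<Sum>i<n. u' i * b' i) \<noteq> 0"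
        then obtain u' where u': "\<forall>k<m. dot u' (a k) = 0" "dot u' b' \<noteq> 0"
          unfolding dot_def by blast
        \<comment> \<open>The multiple of \<open>u\<close> makes \<open>w\<close> orthogonal to \<open>a m\<close> without changing its products with
          the earlier rows; its product with \<open>b\<close> is that of \<open>u'\<close> with \<open>b'\<close>.\<close>
        define w where "w i = ?\<alpha> * u' i - dot u' (a m) * u i" for i
        have w: "dot w x = ?\<alpha> * dot u' x - dot u' (a m) * dot u x" for x
          unfolding w_def by (rule dot_comb(2))
        have "dot w b \<noteq> 0"
          using u'(2) unfolding w b'_def[abs_def] dot_comb(1) by (simp add: mult.commute)
        moreover have "dot w (a k) = 0" if "k < Suc m" for k
          using that u(1) u'(1) by (auto simp: w less_Suc_eq)
        ultimately show ?thesis unfolding dot_def by blast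
      qed
    qed
  qed
qed

lemma covector_kernel_orthogonal:
  assumes "c \<in> covectors A" and "w \<in> mat_kernel A"
  shows "(\<Sum>i<dim_col A. c $ i * w $ i) = 0"
proof -
  obtain v where v: "v \<in> carrier_vec (dim_row A)"
    and c: "c = vec (dim_col A) (\<lambda>i. v \<bullet> col A i)"
    using assms(1) unfolding covectors_def by blast
  have w: "w \<in> carrier_vec (dim_col A)" "A *\<^sub>v w = 0\<^sub>v (dim_row A)"
    using assms(2) by (auto simp: mat_kernel_def)
  have c': "c = A\<^sup>T *\<^sub>v v"
    unfolding c using v by (intro eq_vecI) (auto simp: comm_scalar_prod[of _ "dim_row A"])
  have "c \<bullet> w = v \<bullet> (A *\<^sub>v w)"
    unfolding c' using v w(1) by (intro transpose_vec_mult_scalar) auto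
  then show ?thesis using v w by (simp add: scalar_prod_def atLeast0LessThan)
qed

lemma covectors_add:
  assumes "c \<in> covectors A" and "d \<in> covectors A"
  shows "c + d \<in> covectors A"
proof -
  obtain v w where "v \<in> carrier_vec (dim_row A)" "c = vec (dim_col A) (\<lambda>i. v \<bullet> col A i)"
    "w \<in> carrier_vec (dim_row A)" "d = vec (dim_col A) (\<lambda>i. w \<bullet> col A i)"
    using assms unfolding covectors_def by blast
  then have "c + d = vec (dim_col A) (\<lambda>i. (v + w) \<bullet> col A i)" "v + w \<in> carrier_vec (dim_row A)"
    by (auto intro!: eq_vecI simp: add_scalar_prod_distrib[of _ "dim_row A"])
  then show ?thesis unfolding covectors_def by blast
qed

lemma covectors_carrier: "c \<in> covectors A \<Longrightarrow> c \<in> carrier_vec (dim_col A)"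
  by (auto simp: covectors_def)

text \<open>A co-vector supported on \<open>{i}\<close> is orthogonal to the kernel, which forces coordinate \<open>i\<close> of kernel
  elements to vanish.  Conversely the Fredholm alternative for the \<open>i\<close>-th unit vector produces a
  co-vector with support \<open>{i}\<close>, and a singleton support is automatically minimal.\<close>

lemma free_indices_iff_kernel_vanishes:
  "i \<in> free_indices A \<longleftrightarrow> i < dim_col A \<and> (\<forall>w \<in> mat_kernel A. w $ i = 0)"
proof
  assume "i \<in> free_indices A"
  then obtain c where i: "i < dim_col A" and c: "c \<in> covectors A" "vec_support c = {i}"
    by (auto simp: free_indices_def cocircuits_def)
  have "w $ i = 0" if "w \<in> mat_kernel A" for w
  proof -
    have "c $ j = 0" if "j < dim_col A" "j \<noteq> i" for j
      using c that covectors_carrier[OF c(1)] by (auto simp: vec_support_def)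
    then have "(\<Sum>j<dim_col A. c $ j * w $ j) = (\<Sum>j\<in>{i}. c $ j * w $ j)"
      using i by (intro sum.mono_neutral_right) auto
    then have "c $ i * w $ i = 0" using covector_kernel_orthogonal[OF c(1) that] by simp
    moreover have "c $ i \<noteq> 0" using c(2) by (auto simp: vec_support_def)
    ultimately show ?thesis by simp
  qed
  with i show "i < dim_col A \<and> (\<forall>w \<in> mat_kernel A. w $ i = 0)" by blast
next
  assume asm: "i < dim_col A \<and> (\<forall>w \<in> mat_kernel A. w $ i = 0)"
  let ?n = "dim_col A" and ?m = "dim_row A"
  let ?e = "\<lambda>j. if j = i then 1 else 0 :: int"
  have "\<not> (\<exists>u. (\<forall>k<?m. (\<Sum>j<?n. u j * A $$ (k, j)) = 0) \<and> (\<Sum>j<?n. u j * ?e j) \<noteq> 0)"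
  proof
    assume "\<exists>u. (\<forall>k<?m. (\<Sum>j<?n. u j * A $$ (k, j)) = 0) \<and> (\<Sum>j<?n. u j * ?e j) \<noteq> 0"
    then obtain u where u: "\<forall>k<?m. (\<Sum>j<?n. u j * A $$ (k, j)) = 0" "(\<Sum>j<?n. u j * ?e j) \<noteq> 0"
      by blast
    have "vec ?n u \<in> mat_kernel A" using u(1)
      by (auto simp: mat_kernel_def scalar_prod_def atLeast0LessThan mult.commute intro!: eq_vecI)
    moreover have "u i \<noteq> 0" using u(2) asm by (simp add: if_distrib cong: if_cong)
    ultimately show False using asm by force
  qed
  then obtain c v where cv: "c \<noteq> 0" "\<forall>j<?n. c * ?e j = (\<Sum>k<?m. v k * A $$ (k, j))"
    using fredholm_alternative_int[where n = ?n and b = ?e and m = ?m and a = "\<lambda>k j. A $$ (k, j)"]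
    by blast
  define x where "x = vec ?n (\<lambda>j. vec ?m v \<bullet> col A j)"
  have x: "x \<in> covectors A" unfolding x_def covectors_def by force
  have "x $ j = c * ?e j" if "j < ?n" for j
    using cv(2) that by (simp add: x_def scalar_prod_def atLeast0LessThan)
  then have sx: "vec_support x = {i}"
    using asm cv(1) by (auto simp: vec_support_def x_def split: if_splits)
  have small: "y = 0\<^sub>v ?n" if y: "y \<in> covectors A" "vec_support y \<subset> {i}" for y
  proof -
    have "vec_support y = {}" using y(2) by blast
    then show ?thesis
      using covectors_carrier[OF y(1)] by (intro eq_vecI) (auto simp: vec_support_def)
  qed
  have "vec_support (0\<^sub>v ?n) = {}" by (auto simp: vec_support_def)
  then have "x \<noteq> 0\<^sub>v ?n" using sx by auto
  moreover have "\<not> (\<exists>y \<in> covectors A. y \<noteq> 0\<^sub>v ?n \<and> vec_support y \<subset> vec_support x)"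
    unfolding sx by (rule notI, elim bexE conjE) (rule notE[OF _ small])
  ultimately have "x \<in> cocircuits A"
    using x unfolding cocircuits_def by (intro CollectI conjI)
  with sx asm show "i \<in> free_indices A" by (auto simp: free_indices_def)
qed

section \<open>Structure of bouquets\<close>

abbreviation bouquet_rel :: "int mat \<Rightarrow> (nat \<times> nat) set" where
  "bouquet_rel A \<equiv> (bouquet_edges A)\<^sup>* \<inter> {..<dim_col A} \<times> {..<dim_col A}"

lemma equiv_bouquet_rel: "equiv {..<dim_col A} (bouquet_rel A)"
proof -
  have "sym (bouquet_edges A)" by (auto simp: sym_def bouquet_edges_def insert_commute)
  then have "sym ((bouquet_edges A)\<^sup>*)" by (rule sym_rtrancl)
  then show ?thesis
    by (auto simp: equiv_def refl_on_def sym_def trans_def intro: rtrancl_trans)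
qed

text \<open>An edge \<open>{j, k}\<close> comes from a co-vector \<open>c\<close>, and orthogonality to the kernel reads
  \<open>c $ j * w $ j + c $ k * w $ k = 0\<close> with both coefficients nonzero.  Such homogeneous relations
  compose along a path.\<close>

lemma connected_imp_parallel:
  assumes "(i, j) \<in> (bouquet_edges A)\<^sup>*"
  shows "\<exists>p q. p \<noteq> 0 \<and> q \<noteq> 0 \<and> (\<forall>w \<in> mat_kernel A. p * w $ i = q * w $ j)"
  using assms
proof (induction rule: rtrancl_induct)
  case base
  show ?case by (rule exI[of _ 1], rule exI[of _ 1]) simp
next
  case (step j k)
  obtain p q where pq: "p \<noteq> 0" "q \<noteq> 0" "\<forall>w \<in> mat_kernel A. p * w $ i = q * w $ j"
    using step.IH by blast
  obtain c where jk: "j < dim_col A" "k < dim_col A" "j \<noteq> k"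
    and c: "c \<in> covectors A" "vec_support c = {j, k}"
    using step.hyps(2) by (auto simp: bouquet_edges_def)
  have nz: "c $ j \<noteq> 0" "c $ k \<noteq> 0" using c(2) by (auto simp: vec_support_def)
  have "c $ j * p * w $ i = - q * c $ k * w $ k" if w: "w \<in> mat_kernel A" for w
  proof -
    have "c $ l = 0" if "l < dim_col A" "l \<notin> {j, k}" for l
      using c that covectors_carrier[OF c(1)] by (auto simp: vec_support_def)
    then have "(\<Sum>l<dim_col A. c $ l * w $ l) = (\<Sum>l\<in>{j, k}. c $ l * w $ l)"
      using jk by (intro sum.mono_neutral_right) auto
    then have "c $ j * w $ j = - (c $ k * w $ k)"
      using covector_kernel_orthogonal[OF c(1) w] jk by simp
    moreover have "c $ j * p * w $ i = q * (c $ j * w $ j)" using pq(3) w by simp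
    ultimately show ?thesis by simp
  qed
  moreover have "c $ j * p \<noteq> 0" "- q * c $ k \<noteq> 0" using nz pq by auto
  ultimately show ?case by blast
qed

text \<open>Vanishing on the kernel is passed on by proportionality, so freeness spreads over the whole
  bouquet.  Two free indices are adjacent because the sum of their singleton co-vectors is a co-vector
  supported on the pair.\<close>

lemma bouquet_with_free_index:
  assumes "B \<in> bouquets A" and "i \<in> B" and "i \<in> free_indices A"
  shows "B = free_indices A"
proof -
  have B: "B = bouquet_rel A `` {i}"
  proof -
    obtain x where "B = bouquet_rel A `` {x}"
      using assms(1) unfolding bouquets_def by (rule quotientE)
    moreover from this assms(2) have "(x, i) \<in> bouquet_rel A" by blast
    ultimately show ?thesis using equiv_class_eq[OF equiv_bouquet_rel] by simp
  qed
  have i: "i < dim_col A" "\<forall>w \<in> mat_kernel A. w $ i = 0"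
    using assms(3) free_indices_iff_kernel_vanishes by blast+
  show ?thesis
  proof (intro equalityI subsetI)
    fix j assume "j \<in> B"
    then have j: "(i, j) \<in> (bouquet_edges A)\<^sup>*" "j < dim_col A" using B by auto
    obtain p q where "q \<noteq> 0" "\<forall>w \<in> mat_kernel A. p * w $ i = q * w $ j"
      using connected_imp_parallel[OF j(1)] by blast
    with i j show "j \<in> free_indices A" by (auto simp: free_indices_iff_kernel_vanishes)
  next
    fix j assume j: "j \<in> free_indices A"
    then have jn: "j < dim_col A" by (auto simp: free_indices_def)
    show "j \<in> B"
    proof (cases "j = i")
      case False
      obtain c d where c: "c \<in> covectors A" "vec_support c = {i}"
        and d: "d \<in> covectors A" "vec_support d = {j}"
        using assms(3) j by (auto simp: free_indices_def cocircuits_def)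
      have cd: "c $ l \<noteq> 0 \<longleftrightarrow> l = i" "d $ l \<noteq> 0 \<longleftrightarrow> l = j" if "l < dim_col A" for l
        using c d that covectors_carrier[OF c(1)] covectors_carrier[OF d(1)]
        by (auto simp: vec_support_def)
      have "vec_support (c + d) = {i, j}"
      proof (rule Set.set_eqI)
        fix l
        show "l \<in> vec_support (c + d) \<longleftrightarrow> l \<in> {i, j}"
        proof (cases "l < dim_col A")
          case True
          have "(c + d) $ l = c $ l + d $ l" using True covectors_carrier[OF d(1)] by simp
          moreover have "c $ l = 0 \<or> d $ l = 0" using cd[OF True] False by auto
          ultimately have "(c + d) $ l \<noteq> 0 \<longleftrightarrow> c $ l \<noteq> 0 \<or> d $ l \<noteq> 0" by auto
          then show ?thesis using cd[OF True] True covectors_carrier[OF d(1)]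
            by (auto simp: vec_support_def)
        next
          case l: False
          then show ?thesis using i jn covectors_carrier[OF d(1)] by (auto simp: vec_support_def)
        qed
      qed
      then have "(i, j) \<in> bouquet_edges A"
        using i jn False covectors_add[OF c(1) d(1)] by (auto simp: bouquet_edges_def)
      then show ?thesis using B i jn by auto
    qed (use assms in simp)
  qed
qed

section \<open>Lifting along columns with disjoint supports\<close>

text \<open>The conditions on positive and negative parts say that \<open>v\<close> and \<open>w\<close> never have
  opposite signs in a coordinate.\<close>

lemma conformal_decomp_iff:
  assumes "u \<in> carrier_vec N" "v \<in> carrier_vec N" "w \<in> carrier_vec N"
  shows "conformal_decomp u v w \<longleftrightarrow> (\<forall>i<N. u $ i = v $ i + w $ i \<and> 0 \<le> v $ i * w $ i)"
proof -
  have int: "x = a + b \<and> max x 0 = max a 0 + max b 0 \<and> max (- x) 0 = max (- a) 0 + max (- b) 0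
    \<longleftrightarrow> x = a + b \<and> 0 \<le> a * b" for x a b :: int
    by (auto simp: zero_le_mult_iff)
  have "conformal_decomp u v w \<longleftrightarrow> (\<forall>i<N. u $ i = v $ i + w $ i \<and>
      max (u $ i) 0 = max (v $ i) 0 + max (w $ i) 0 \<and>
      max (- u $ i) 0 = max (- v $ i) 0 + max (- w $ i) 0)"
    using assms by (auto simp: conformal_decomp_def pos_vec_def neg_vec_def vec_eq_iff)
  then show ?thesis by (simp only: int)
qed

lemma bij_betw_restrict:
  assumes "bij_betw F K L" "S \<subseteq> K" "T \<subseteq> L" "\<And>x. x \<in> K \<Longrightarrow> F x \<in> T \<longleftrightarrow> x \<in> S"
  shows "bij_betw F S T"
proof (rule bij_betw_imageI)
  show "inj_on F S" using assms(1,2) by (meson bij_betw_def inj_on_subset)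
  show "F ` S = T" using assms by (auto simp: bij_betw_def image_iff) blast
qed

text \<open>Here \<open>blk i\<close> is the position of the only nonzero entry in row \<open>i\<close> of \<open>C\<close>, so the fibres of \<open>blk\<close>
  are the supports of the columns.  The last assumption is the dichotomy between the free
  bouquet and the others: kernel elements of \<open>A\<close> either vanish on a block or are parallel there to
  the column of \<open>C\<close>, which is then primitive.\<close>

locale bouquet_lift =
  fixes A C :: "int mat" and m n s :: nat and blk :: "nat \<Rightarrow> nat"
  assumes A: "A \<in> carrier_mat m n" and C: "C \<in> carrier_mat n s"
    and blk_less: "\<And>i. i < n \<Longrightarrow> blk i < s"
    and nonzero_iff: "\<And>i k. i < n \<Longrightarrow> k < s \<Longrightarrow> C $$ (i, k) \<noteq> 0 \<longleftrightarrow> blk i = k"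
    and blk_onto: "\<And>k. k < s \<Longrightarrow> \<exists>i<n. blk i = k"
    and vanishing_or_primitive: "\<And>k. k < s \<Longrightarrow>
      (\<forall>w \<in> mat_kernel A. \<forall>i<n. blk i = k \<longrightarrow> w $ i = 0) \<or>
      (Gcd ((\<lambda>i. C $$ (i, k)) ` {i. i < n \<and> blk i = k}) = 1 \<and>
       (\<forall>w \<in> mat_kernel A. \<forall>i<n. \<forall>j<n. blk i = k \<longrightarrow> blk j = k \<longrightarrow>
          w $ i * C $$ (j, k) = w $ j * C $$ (i, k)))"
begin

lemma lift_carrier: "C *\<^sub>v u \<in> carrier_vec n"
  using C by (auto intro: carrier_vecI)

lemma lift_index:
  assumes "u \<in> carrier_vec s" and i: "i < n"
  shows "(C *\<^sub>v u) $ i = C $$ (i, blk i) * u $ blk i"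
proof -
  have "(C *\<^sub>v u) $ i = (\<Sum>k<s. C $$ (i, k) * u $ k)"
    using assms C by (auto simp: scalar_prod_def atLeast0LessThan)
  also have "\<dots> = (\<Sum>k\<in>{blk i}. C $$ (i, k) * u $ k)"
    using nonzero_iff[OF i] blk_less[OF i] by (intro sum.mono_neutral_right) auto
  finally show ?thesis by simp
qed

lemma entry_nonzero: "i < n \<Longrightarrow> C $$ (i, blk i) \<noteq> 0"
  using nonzero_iff blk_less by blast

lemma lift_index_zero_iff: "u \<in> carrier_vec s \<Longrightarrow> i < n \<Longrightarrow> (C *\<^sub>v u) $ i = 0 \<longleftrightarrow> u $ blk i = 0"
  by (simp add: lift_index entry_nonzero)

lemma kernel_carrier: "w \<in> mat_kernel A \<Longrightarrow> w \<in> carrier_vec n"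
  using A by (auto simp: mat_kernel_def)

lemma lift_in_kernel_iff:
  "u \<in> mat_kernel (A * C) \<longleftrightarrow> u \<in> carrier_vec s \<and> C *\<^sub>v u \<in> mat_kernel A"
proof -
  have "(A * C) *\<^sub>v u = A *\<^sub>v (C *\<^sub>v u)" if "u \<in> carrier_vec s"
    using A C that by (rule assoc_mult_mat_vec)
  then show ?thesis using A C lift_carrier[of u] by (auto simp: mat_kernel_def)
qed

lemma lift_inj: "inj_on ((*\<^sub>v) C) (carrier_vec s)"
proof (rule inj_onI)
  fix u v assume uv: "u \<in> carrier_vec s" "v \<in> carrier_vec s" "C *\<^sub>v u = C *\<^sub>v v"
  show "u = v"
  proof (rule eq_vecI)
    fix k assume "k < dim_vec v"
    then obtain i where i: "i < n" "blk i = k" using blk_onto uv by auto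
    then show "u $ k = v $ k"
      using lift_index[OF uv(1) i(1)] lift_index[OF uv(2) i(1)] uv(3) entry_nonzero[OF i(1)] by simp
  qed (use uv in auto)
qed

lemma dvd_blockD:
  assumes k: "k < s" and "Gcd ((\<lambda>i. C $$ (i, k)) ` {i. i < n \<and> blk i = k}) = 1"
    and "\<And>i. i < n \<Longrightarrow> blk i = k \<Longrightarrow> d dvd x * C $$ (i, k)"
  shows "d dvd x"
proof -
  let ?S = "(\<lambda>i. C $$ (i, k)) ` {i. i < n \<and> blk i = k}"
  have "d dvd Gcd ((*) x ` ?S)" using assms(3) by (auto intro!: Gcd_greatest)
  also have "Gcd ((*) x ` ?S) = normalize (x * Gcd ?S)" by (rule Gcd_mult)
  finally show ?thesis using assms(2) by simp
qed

text \<open>On a primitive block, fix an index \<open>l\<close>.  The cross relations show that \<open>C $$ (l, k)\<close> divides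
  \<open>w $ l\<close> times every entry of the column, hence \<open>w $ l\<close> itself; the quotient is the coordinate
  of the preimage.  On a block where the kernel vanishes this coordinate is 0.\<close>

lemma lift_surj:
  assumes w: "w \<in> mat_kernel A"
  shows "\<exists>u \<in> carrier_vec s. C *\<^sub>v u = w"
proof -
  have "\<exists>t. \<forall>i<n. blk i = k \<longrightarrow> w $ i = C $$ (i, k) * t" if k: "k < s" for k
    using vanishing_or_primitive[OF k]
  proof
    assume "\<forall>w \<in> mat_kernel A. \<forall>i<n. blk i = k \<longrightarrow> w $ i = 0"
    then show ?thesis using w by (intro exI[of _ 0]) auto
  next
    assume prim: "Gcd ((\<lambda>i. C $$ (i, k)) ` {i. i < n \<and> blk i = k}) = 1 \<and>
       (\<forall>w \<in> mat_kernel A. \<forall>i<n. \<forall>j<n. blk i = k \<longrightarrow> blk j = k \<longrightarrow>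
          w $ i * C $$ (j, k) = w $ j * C $$ (i, k))"
    obtain l where l: "l < n" "blk l = k" using blk_onto[OF k] by blast
    have cross: "w $ l * C $$ (i, k) = w $ i * C $$ (l, k)" if "i < n" "blk i = k" for i
      using prim w l that by blast
    have "C $$ (l, k) dvd w $ l"
      using k conjunct1[OF prim] by (rule dvd_blockD) (simp add: cross)
    then obtain t where t: "w $ l = C $$ (l, k) * t" by (rule dvdE)
    have "w $ i = C $$ (i, k) * t" if "i < n" "blk i = k" for i
      using cross[OF that] t entry_nonzero[OF l(1)] l(2) by (simp add: ac_simps)
    then show ?thesis by blast
  qed
  then obtain t where t: "\<And>k i. k < s \<Longrightarrow> i < n \<Longrightarrow> blk i = k \<Longrightarrow> w $ i = C $$ (i, k) * t k"
    by metis
  have "C *\<^sub>v vec s t = w"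
    using C kernel_carrier[OF w] t[OF blk_less _ refl] blk_less
    by (intro eq_vecI) (auto simp: lift_index simp del: index_mult_mat_vec)
  then show ?thesis by (intro bexI[of _ "vec s t"]) auto
qed

lemma lift_bij_kernel: "bij_betw ((*\<^sub>v) C) (mat_kernel (A * C)) (mat_kernel A)"
proof (rule bij_betw_imageI)
  show "inj_on ((*\<^sub>v) C) (mat_kernel (A * C))"
    using lift_inj by (rule inj_on_subset) (auto simp: lift_in_kernel_iff)
  show "(*\<^sub>v) C ` mat_kernel (A * C) = mat_kernel A"
  proof (intro equalityI subsetI)
    fix w assume "w \<in> mat_kernel A"
    moreover from this obtain u where "u \<in> carrier_vec s" "C *\<^sub>v u = w"
      using lift_surj by blast
    ultimately show "w \<in> (*\<^sub>v) C ` mat_kernel (A * C)"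
      by (auto simp: lift_in_kernel_iff)
  qed (auto simp: lift_in_kernel_iff)
qed

lemma lift_eq_zero_iff:
  assumes "u \<in> carrier_vec s"
  shows "C *\<^sub>v u = 0\<^sub>v n \<longleftrightarrow> u = 0\<^sub>v s"
proof -
  have "C *\<^sub>v 0\<^sub>v s = 0\<^sub>v n" using C by (auto intro!: eq_vecI)
  then show ?thesis using inj_onD[OF lift_inj, of u "0\<^sub>v s"] assms by auto
qed

text \<open>Coordinates in one block are multiplied by the same nonzero number, so the signs of the products
  \<open>v $ k * w $ k\<close> do not change.\<close>

lemma lift_conformal_iff:
  assumes "u \<in> carrier_vec s" "v \<in> carrier_vec s" "w \<in> carrier_vec s"
  shows "conformal_decomp (C *\<^sub>v u) (C *\<^sub>v v) (C *\<^sub>v w) \<longleftrightarrow> conformal_decomp u v w"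
proof -
  have "(C *\<^sub>v u) $ i = (C *\<^sub>v v) $ i + (C *\<^sub>v w) $ i \<and> 0 \<le> (C *\<^sub>v v) $ i * (C *\<^sub>v w) $ i
      \<longleftrightarrow> u $ blk i = v $ blk i + w $ blk i \<and> 0 \<le> v $ blk i * w $ blk i" if i: "i < n" for i
  proof -
    let ?c = "C $$ (i, blk i)"
    have "?c * u $ blk i = ?c * v $ blk i + ?c * w $ blk i \<longleftrightarrow> u $ blk i = v $ blk i + w $ blk i"
      using entry_nonzero[OF i] by (simp flip: distrib_left)
    moreover have "0 \<le> ?c * v $ blk i * (?c * w $ blk i) \<longleftrightarrow> 0 \<le> v $ blk i * w $ blk i"
    proof -
      have "?c * v $ blk i * (?c * w $ blk i) = (?c * ?c) * (v $ blk i * w $ blk i)"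
        by (simp add: ac_simps)
      moreover have "0 < ?c * ?c" using entry_nonzero[OF i] by (auto simp: zero_less_mult_iff)
      ultimately show ?thesis by (simp only: zero_le_mult_iff[of "?c * ?c"]) linarith
    qed
    ultimately show ?thesis using i assms by (simp only: lift_index)
  qed
  then show ?thesis
    unfolding conformal_decomp_iff[OF lift_carrier lift_carrier lift_carrier]
      conformal_decomp_iff[OF assms]
    by (metis blk_less blk_onto)
qed

lemma lift_graver_iff:
  assumes u: "u \<in> mat_kernel (A * C)"
  shows "C *\<^sub>v u \<in> graver_basis A \<longleftrightarrow> u \<in> graver_basis (A * C)"
proof -
  note iff = lift_in_kernel_iff
  have img: "mat_kernel A = (*\<^sub>v) C ` mat_kernel (A * C)"
    using lift_bij_kernel by (simp add: bij_betw_def)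
  have dims: "dim_col A = n" "dim_col (A * C) = s" using A C by auto
  show ?thesis
    using u unfolding graver_basis_def dims mem_Collect_eq
    by (subst (2 3) img) (auto simp: iff lift_eq_zero_iff lift_conformal_iff)
qed

lemma lift_support_subset_iff:
  assumes "u \<in> carrier_vec s" "v \<in> carrier_vec s"
  shows "vec_support (C *\<^sub>v u) \<subseteq> vec_support (C *\<^sub>v v) \<longleftrightarrow> vec_support u \<subseteq> vec_support v"
proof -
  have supp: "vec_support (C *\<^sub>v x) = {i. i < n \<and> blk i \<in> vec_support x}" if "x \<in> carrier_vec s" for x
    using that carrier_vecD[OF lift_carrier, of x] blk_less
    by (auto simp: vec_support_def lift_index_zero_iff
        simp del: index_mult_mat_vec dim_mult_mat_vec)
  have "vec_support u \<subseteq> {..<s}" using assms by (auto simp: vec_support_def)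
  then show ?thesis using blk_onto unfolding supp[OF assms(1)] supp[OF assms(2)] by blast
qed

text \<open>On a block where the kernel vanishes, both \<open>u\<close> and its lift are 0; this is what permits an arbitrary
  vector on the free bouquet.  On every other block the column is primitive.\<close>

lemma lift_content:
  assumes u: "u \<in> mat_kernel (A * C)"
  shows "Gcd (set\<^sub>v (C *\<^sub>v u)) = Gcd (set\<^sub>v u)"
proof -
  have uc: "u \<in> carrier_vec s" and uk: "C *\<^sub>v u \<in> mat_kernel A"
    using u lift_in_kernel_iff by blast+
  have "(\<forall>i<n. d dvd (C *\<^sub>v u) $ i) \<longleftrightarrow> (\<forall>k<s. d dvd u $ k)" for d
  proof
    assume d: "\<forall>i<n. d dvd (C *\<^sub>v u) $ i"
    show "\<forall>k<s. d dvd u $ k"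
    proof (intro allI impI)
      fix k assume k: "k < s"
      from vanishing_or_primitive[OF k] show "d dvd u $ k"
      proof
        assume "\<forall>w \<in> mat_kernel A. \<forall>i<n. blk i = k \<longrightarrow> w $ i = 0"
        then have "u $ k = 0" using uk blk_onto[OF k] lift_index_zero_iff[OF uc] by metis
        then show ?thesis by simp
      next
        assume prim: "Gcd ((\<lambda>i. C $$ (i, k)) ` {i. i < n \<and> blk i = k}) = 1 \<and>
          (\<forall>w \<in> mat_kernel A. \<forall>i<n. \<forall>j<n. blk i = k \<longrightarrow> blk j = k \<longrightarrow>
            w $ i * C $$ (j, k) = w $ j * C $$ (i, k))"
        show ?thesis
        proof (rule dvd_blockD[OF k conjunct1[OF prim]])
          fix i assume "i < n" "blk i = k"
          then show "d dvd u $ k * C $$ (i, k)" using d lift_index[OF uc] by (metis mult.commute)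
        qed
      qed
    qed
  next
    assume "\<forall>k<s. d dvd u $ k"
    then show "\<forall>i<n. d dvd (C *\<^sub>v u) $ i"
      using blk_less lift_index[OF uc] by (metis dvd_mult)
  qed
  moreover have "d dvd Gcd (set\<^sub>v x) \<longleftrightarrow> (\<forall>k<N. d dvd x $ k)" if "x \<in> carrier_vec N"
    for d :: int and x N
    using that by (auto simp: dvd_Gcd_iff vec_set_def)
  ultimately have "d dvd Gcd (set\<^sub>v (C *\<^sub>v u)) \<longleftrightarrow> d dvd Gcd (set\<^sub>v u)" for d
    using lift_carrier uc by metis
  then show ?thesis by (metis dvd_refl dvd_antisym Gcd_int_greater_eq_0 zdvd_antisym_nonneg)
qed

lemma lift_circuit_iff:
  assumes u: "u \<in> mat_kernel (A * C)"
  shows "C *\<^sub>v u \<in> matrix_circuits A \<longleftrightarrow> u \<in> matrix_circuits (A * C)"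
proof -
  have img: "mat_kernel A = (*\<^sub>v) C ` mat_kernel (A * C)"
    using lift_bij_kernel by (simp add: bij_betw_def)
  have dims: "dim_col A = n" "dim_col (A * C) = s" using A C by auto
  have psub: "vec_support (C *\<^sub>v v) \<subset> vec_support (C *\<^sub>v u) \<longleftrightarrow> vec_support v \<subset> vec_support u"
    if "v \<in> carrier_vec s" for v
    using that u lift_support_subset_iff by (simp add: lift_in_kernel_iff less_le_not_le)
  show ?thesis
    using u unfolding matrix_circuits_def dims mem_Collect_eq lift_content[OF u]
    by (subst (2) img) (auto simp: lift_in_kernel_iff lift_eq_zero_iff psub)
qed

lemma lift_bij_graver: "bij_betw ((*\<^sub>v) C) (graver_basis (A * C)) (graver_basis A)"
  using lift_bij_kernel
  by (rule bij_betw_restrict) (use lift_graver_iff in \<open>auto simp: graver_basis_def\<close>)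

lemma lift_bij_circuits: "bij_betw ((*\<^sub>v) C) (matrix_circuits (A * C)) (matrix_circuits A)"
  using lift_bij_kernel
  by (rule bij_betw_restrict) (use lift_circuit_iff in \<open>auto simp: matrix_circuits_def\<close>)

end

section \<open>The bouquet vectors\<close>

lemma gale_column_in_kernel:
  assumes "is_gale_matrix A G" and "j < dim_col G"
  shows "\<exists>w \<in> mat_kernel A. \<forall>i < dim_col A. w $ i = G $$ (i, j)"
proof (intro bexI allI impI)
  let ?d = "dim_col A - int_rank A"
  have G: "G \<in> carrier_mat (dim_col A) ?d"
    and bij: "bij_betw (\<lambda>x. G *\<^sub>v x) (carrier_vec ?d) (mat_kernel A)"
    using assms(1) by (auto simp: is_gale_matrix_def)
  show "G *\<^sub>v unit_vec ?d j \<in> mat_kernel A"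
    using bij by (auto simp: bij_betw_def)
  fix i assume "i < dim_col A"
  then show "(G *\<^sub>v unit_vec ?d j) $ i = G $$ (i, j)"
    using G assms(2) by (simp add: scalar_prod_right_unit)
qed

lemma nonfree_imp_gale_entry:
  assumes gale: "is_gale_matrix A G" and i: "i < dim_col A" "i \<notin> free_indices A"
  shows "\<exists>j < dim_col G. G $$ (i, j) \<noteq> 0"
proof -
  let ?d = "dim_col A - int_rank A"
  have G: "G \<in> carrier_mat (dim_col A) ?d"
    and bij: "bij_betw (\<lambda>x. G *\<^sub>v x) (carrier_vec ?d) (mat_kernel A)"
    using gale by (auto simp: is_gale_matrix_def)
  obtain w where "w \<in> mat_kernel A" "w $ i \<noteq> 0"
    using i free_indices_iff_kernel_vanishes by blast
  moreover from this obtain x where "x \<in> carrier_vec ?d" "w = G *\<^sub>v x"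
    using bij by (auto simp: bij_betw_def image_iff)
  ultimately have "(\<Sum>j<?d. G $$ (i, j) * x $ j) \<noteq> 0"
    using G i(1) by (simp add: scalar_prod_def atLeast0LessThan)
  then obtain j where "j < ?d" "G $$ (i, j) * x $ j \<noteq> 0"
    by (meson sum.neutral lessThan_iff)
  then show ?thesis using G by auto
qed

lemma bouquet_subset: "B \<in> bouquets A \<Longrightarrow> B \<subseteq> {..<dim_col A}"
  unfolding bouquets_def using equiv_bouquet_rel[of A] Union_quotient by blast

lemma bouquet_nonempty: "B \<in> bouquets A \<Longrightarrow> B \<noteq> {}"
  unfolding bouquets_def using equiv_bouquet_rel[of A] in_quotient_imp_non_empty by blast

lemma bouquet_parallel:
  assumes "B \<in> bouquets A" "i \<in> B" "l \<in> B"
  shows "\<exists>p q. p \<noteq> 0 \<and> q \<noteq> 0 \<and> (\<forall>w \<in> mat_kernel A. p * w $ i = q * w $ l)"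
proof -
  have "(i, l) \<in> bouquet_rel A"
    using assms quotient_eq_iff[OF equiv_bouquet_rel, of B A B i l] by (auto simp: bouquets_def)
  then show ?thesis using connected_imp_parallel by blast
qed

text \<open>These are the properties of \<open>c\<^sub>B\<close> that do not depend on the chosen Gale coordinate \<open>j\<close>.  Such a \<open>j\<close>
  exists because a non-free index has a nonzero Gale entry, and proportionality, applied to the
  corresponding Gale column as a kernel element, makes that column nonzero on all of \<open>B\<close>.  The
  identity \<open>g * c = e * G\<close> on \<open>B\<close> then turns facts about this Gale column into facts about \<open>c\<^sub>B\<close>.\<close>

lemma nonfree_bouquet_vec:
  assumes gale: "is_gale_matrix A G" and B: "B \<in> bouquets A" and nonfree: "B \<noteq> free_indices A"
  shows "bouquet_vec A G f B \<in> carrier_vec (dim_col A)" (is "?c \<in> _")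
    and "\<And>i. i < dim_col A \<Longrightarrow> bouquet_vec A G f B $ i \<noteq> 0 \<longleftrightarrow> i \<in> B"
    and "Gcd ((\<lambda>i. bouquet_vec A G f B $ i) ` B) = 1"
    and "\<And>w i l. w \<in> mat_kernel A \<Longrightarrow> i \<in> B \<Longrightarrow> l \<in> B \<Longrightarrow>
      w $ i * bouquet_vec A G f B $ l = w $ l * bouquet_vec A G f B $ i"
proof -
  define j where "j = (SOME j. j < dim_col G \<and> (\<forall>i\<in>B. G $$ (i, j) \<noteq> 0))"
  define g where "g = Gcd ((\<lambda>i. G $$ (i, j)) ` B)"
  define e where "e = sgn (G $$ (Min B, j))"
  have Bn: "B \<subseteq> {..<dim_col A}" and Bne: "B \<noteq> {}"
    using bouquet_subset[OF B] bouquet_nonempty[OF B] by auto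
  then have finB: "finite B" and MinB: "Min B \<in> B"
    using finite_subset by (auto intro: Min_in finite_subset)
  have c: "?c = vec (dim_col A) (\<lambda>i. if i \<in> B then (e * G $$ (i, j)) div g else 0)"
    unfolding bouquet_vec_def Let_def if_not_P[OF nonfree] j_def[symmetric] g_def[symmetric]
      e_def[symmetric] by (rule refl)
  then show "?c \<in> carrier_vec (dim_col A)" by simp

  have "\<exists>j. j < dim_col G \<and> (\<forall>i\<in>B. G $$ (i, j) \<noteq> 0)"
  proof -
    obtain i where i: "i \<in> B" using Bne by blast
    then have "i \<notin> free_indices A" using bouquet_with_free_index[OF B] nonfree by blast
    then obtain j where j: "j < dim_col G" "G $$ (i, j) \<noteq> 0"
      using nonfree_imp_gale_entry[OF gale] i Bn by blast
    obtain w where w: "w \<in> mat_kernel A" "\<forall>i < dim_col A. w $ i = G $$ (i, j)"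
      using gale_column_in_kernel[OF gale j(1)] by blast
    have "G $$ (l, j) \<noteq> 0" if l: "l \<in> B" for l
    proof -
      have "w $ i = G $$ (i, j)" "w $ l = G $$ (l, j)" using w(2) i l Bn by blast+
      moreover obtain p q where "p \<noteq> 0" "p * w $ i = q * w $ l"
        using bouquet_parallel[OF B i l] w(1) by blast
      ultimately show ?thesis using j(2) by auto
    qed
    with j(1) show ?thesis by blast
  qed
  then have "j < dim_col G \<and> (\<forall>i\<in>B. G $$ (i, j) \<noteq> 0)"
    unfolding j_def by (rule someI_ex)
  then have j: "j < dim_col G" "\<And>i. i \<in> B \<Longrightarrow> G $$ (i, j) \<noteq> 0" by blast+
  have e: "e * e = 1" using j(2)[OF MinB] by (auto simp: e_def sgn_if)
  have g0: "g \<noteq> 0" unfolding g_def using j(2)[OF MinB] MinB by auto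
  have gc: "g * ?c $ i = e * G $$ (i, j)" if "i \<in> B" for i
  proof -
    have "g dvd G $$ (i, j)" unfolding g_def using that by (intro Gcd_dvd) auto
    then show ?thesis using that Bn by (auto simp: c)
  qed
  show "?c $ i \<noteq> 0 \<longleftrightarrow> i \<in> B" if "i < dim_col A" for i
    using that gc[of i] j(2)[of i] e by (auto simp: c)
  show "Gcd ((\<lambda>i. ?c $ i) ` B) = 1"
  proof -
    let ?h = "Gcd ((\<lambda>i. ?c $ i) ` B)"
    have "g * ?h dvd G $$ (i, j)" if "i \<in> B" for i
    proof -
      have "?h dvd ?c $ i" using that by (intro Gcd_dvd) auto
      then have "g * ?h dvd g * ?c $ i" by (rule mult_dvd_mono[OF dvd_refl])
      then have "g * ?h dvd e * (e * G $$ (i, j))" using gc[OF that] by simp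
      then show ?thesis by (metis e mult.assoc mult_1)
    qed
    then have "g * ?h dvd Gcd ((\<lambda>i. G $$ (i, j)) ` B)"
      by (intro Gcd_greatest) auto
    then have "g * ?h dvd g * 1" by (simp add: g_def)
    then have "?h dvd 1" using g0 by (simp only: dvd_mult_cancel_left) simp
    moreover have "0 \<le> ?h" by simp
    ultimately show ?thesis by simp
  qed
  fix w i l assume w: "w \<in> mat_kernel A" and il: "i \<in> B" "l \<in> B"
  obtain v where v: "v \<in> mat_kernel A" "\<forall>i < dim_col A. v $ i = G $$ (i, j)"
    using gale_column_in_kernel[OF gale j(1)] by blast
  obtain p q where pq: "p \<noteq> 0" "q \<noteq> 0" "\<forall>w \<in> mat_kernel A. p * w $ i = q * w $ l"
    using bouquet_parallel[OF B il] by blast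
  have "v $ i = G $$ (i, j)" "v $ l = G $$ (l, j)" using v(2) il Bn by blast+
  then have "p * G $$ (i, j) = q * G $$ (l, j)" using pq(3) v(1) by metis
  have "(q * g) * (w $ i * ?c $ l) = w $ i * e * (q * G $$ (l, j))"
    using gc[OF il(2)] by (simp add: ac_simps)
  also have "\<dots> = e * G $$ (i, j) * (p * w $ i)"
    unfolding \<open>p * G $$ (i, j) = q * G $$ (l, j)\<close>[symmetric] by (simp add: ac_simps)
  also have "\<dots> = (q * g) * (w $ l * ?c $ i)"
    using pq(3) w gc[OF il(1)] by (simp add: ac_simps)
  finally show "w $ i * ?c $ l = w $ l * ?c $ i" using pq(2) g0 by simp
qed

lemma bouquet_vec_carrier_support:
  assumes "is_gale_matrix A G" and "free_indices A \<noteq> {} \<Longrightarrow> is_free_vec A f" and B: "B \<in> bouquets A"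
  shows "bouquet_vec A G f B \<in> carrier_vec (dim_col A)"
    and "i < dim_col A \<Longrightarrow> bouquet_vec A G f B $ i \<noteq> 0 \<longleftrightarrow> i \<in> B"
proof -
  have "bouquet_vec A G f B \<in> carrier_vec (dim_col A) \<and>
    (i < dim_col A \<longrightarrow> (bouquet_vec A G f B $ i \<noteq> 0 \<longleftrightarrow> i \<in> B))"
  proof (cases "B = free_indices A")
    case True
    then have "is_free_vec A f" using assms(2) bouquet_nonempty[OF B] by blast
    then have "f \<in> carrier_vec (dim_col A)" "vec_support f = B"
      using True by (auto simp: is_free_vec_def)
    then show ?thesis using True by (auto simp: bouquet_vec_def vec_support_def)
  next
    case False
    then show ?thesis using nonfree_bouquet_vec(1,2)[OF assms(1) B False] by blast
  qed
  then show "bouquet_vec A G f B \<in> carrier_vec (dim_col A)"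
    and "i < dim_col A \<Longrightarrow> bouquet_vec A G f B $ i \<noteq> 0 \<longleftrightarrow> i \<in> B" by blast+
qed

lemma bouquet_mat_eq_mult:
  assumes "A \<in> carrier_mat m n" and "\<And>B. B \<in> set Bs \<Longrightarrow> bouquet_vec A G f B \<in> carrier_vec n"
  shows "bouquet_mat A G f Bs = A * mat_of_cols n (map (bouquet_vec A G f) Bs)"
  using assms by (intro eq_matI) (auto simp: bouquet_mat_def mat_of_cols_index)

lemma bouquet_map_eq_mult:
  assumes "A \<in> carrier_mat m n" and "\<And>B. B \<in> set Bs \<Longrightarrow> bouquet_vec A G f B \<in> carrier_vec n"
    and "u \<in> carrier_vec (length Bs)"
  shows "bouquet_map A G f Bs u = mat_of_cols n (map (bouquet_vec A G f) Bs) *\<^sub>v u"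
  using assms
  by (intro eq_vecI)
    (auto simp: bouquet_map_def scalar_prod_def atLeast0LessThan mat_of_cols_index)

text \<open>The block of an index is the position in \<open>Bs\<close> of its bouquet, unique because \<open>Bs\<close> enumerates a
  partition without repetition.  The free bouquet is the block where the kernel vanishes.\<close>

lemma bouquet_lift_mat_of_cols:
  assumes A: "A \<in> carrier_mat m n" and gale: "is_gale_matrix A G"
    and free: "free_indices A \<noteq> {} \<Longrightarrow> is_free_vec A f"
    and Bs: "distinct Bs" "set Bs = bouquets A"
  shows "bouquet_lift A (mat_of_cols n (map (bouquet_vec A G f) Bs)) m n (length Bs)
    (\<lambda>i. THE k. k < length Bs \<and> i \<in> Bs ! k)" (is "bouquet_lift A ?C m n ?s ?blk")
proof -
  have n: "dim_col A = n" using A by simp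
  have C: "?C $$ (i, k) = bouquet_vec A G f (Bs ! k) $ i" if "i < n" "k < ?s" for i k
    using that by (simp add: mat_of_cols_index)
  have nth: "Bs ! k \<in> bouquets A" if "k < ?s" for k
    using that Bs(2) nth_mem by blast
  have ex1: "\<exists>!k. k < ?s \<and> i \<in> Bs ! k" if "i < n" for i
  proof -
    have "i \<in> \<Union> (bouquets A)"
      using that n Union_quotient[OF equiv_bouquet_rel[of A]] by (simp add: bouquets_def)
    then obtain k where k: "k < ?s" "i \<in> Bs ! k"
      using Bs(2) by (metis UnionE in_set_conv_nth)
    moreover have "k' = k" if "k' < ?s" "i \<in> Bs ! k'" for k'
    proof -
      have "Bs ! k' = Bs ! k"
        using quotient_disj[OF equiv_bouquet_rel[of A], folded bouquets_def] nth k that by blast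
      then show ?thesis using Bs(1) k(1) that(1) nth_eq_iff_index_eq by blast
    qed
    ultimately show ?thesis by blast
  qed
  have blk: "?blk i = k \<longleftrightarrow> i \<in> Bs ! k" if "i < n" "k < ?s" for i k
    using theI'[OF ex1[OF that(1)]] ex1[OF that(1)] that by blast
  have block: "{i. i < n \<and> ?blk i = k} = Bs ! k" if "k < ?s" for k
    using blk that bouquet_subset[OF nth[OF that]] n by auto
  show ?thesis
  proof
    show "A \<in> carrier_mat m n" by (rule A)
    show "?C \<in> carrier_mat n ?s" using mat_of_cols_carrier(1)[of n "map (bouquet_vec A G f) Bs"] by simp
    show "?blk i < ?s" if "i < n" for i using theI'[OF ex1[OF that]] by blast
    show "?C $$ (i, k) \<noteq> 0 \<longleftrightarrow> ?blk i = k" if "i < n" "k < ?s" for i k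
      using bouquet_vec_carrier_support(2)[OF gale free nth, of k i] that
      unfolding C[OF that] blk[OF that] n by blast
    show "\<exists>i<n. ?blk i = k" if "k < ?s" for k
      using block[OF that] bouquet_nonempty[OF nth[OF that]] by blast
    fix k assume k: "k < ?s"
    show "(\<forall>w \<in> mat_kernel A. \<forall>i<n. ?blk i = k \<longrightarrow> w $ i = 0) \<or>
      (Gcd ((\<lambda>i. ?C $$ (i, k)) ` {i. i < n \<and> ?blk i = k}) = 1 \<and>
       (\<forall>w \<in> mat_kernel A. \<forall>i<n. \<forall>l<n. ?blk i = k \<longrightarrow> ?blk l = k \<longrightarrow>
          w $ i * ?C $$ (l, k) = w $ l * ?C $$ (i, k)))"
    proof (cases "Bs ! k = free_indices A")
      case True
      then show ?thesis using free_indices_iff_kernel_vanishes k by (intro disjI1) (simp add: blk)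
    next
      case False
      have "(\<lambda>i. ?C $$ (i, k)) ` (Bs ! k) = (\<lambda>i. bouquet_vec A G f (Bs ! k) $ i) ` (Bs ! k)"
        using C[OF _ k] bouquet_subset[OF nth[OF k]] unfolding n by (intro image_cong) auto
      then show ?thesis
        unfolding block[OF k]
        using nonfree_bouquet_vec(3,4)[OF gale nth[OF k] False] k
        by (intro disjI2) (simp add: C blk)
    qed
  qed
qed

theorem theoremA:
  fixes A G :: "int mat" and f :: "int vec" and Bs :: "nat set list" and m n :: nat
  assumes "A \<in> carrier_mat m n"
    and "is_gale_matrix A G"
    and "free_indices A \<noteq> {} \<Longrightarrow> is_free_vec A f"
    and "distinct Bs" and "set Bs = bouquets A"
  shows "bij_betw (bouquet_map A G f Bs) (mat_kernel (bouquet_mat A G f Bs)) (mat_kernel A) \<and>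
    bij_betw (bouquet_map A G f Bs) (graver_basis (bouquet_mat A G f Bs)) (graver_basis A) \<and>
    bij_betw (bouquet_map A G f Bs) (matrix_circuits (bouquet_mat A G f Bs)) (matrix_circuits A) \<and>
    graver_basis A = {bouquet_map A G f Bs u | u. u \<in> graver_basis (bouquet_mat A G f Bs)} \<and>
    matrix_circuits A = {bouquet_map A G f Bs u | u. u \<in> matrix_circuits (bouquet_mat A G f Bs)}"
proof -
  let ?C = "mat_of_cols n (map (bouquet_vec A G f) Bs)" and ?F = "bouquet_map A G f Bs"
  let ?AB = "bouquet_mat A G f Bs"
  interpret bouquet_lift A ?C m n "length Bs" "\<lambda>i. THE k. k < length Bs \<and> i \<in> Bs ! k"
    using assms by (rule bouquet_lift_mat_of_cols)
  have carrier: "bouquet_vec A G f B \<in> carrier_vec n" if "B \<in> set Bs" for B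
    using bouquet_vec_carrier_support(1)[OF assms(2,3)] that assms(1,5) by auto
  have AB: "?AB = A * ?C" using assms(1) carrier by (rule bouquet_mat_eq_mult)
  have F: "?F u = ?C *\<^sub>v u" if "u \<in> mat_kernel ?AB" for u
    using assms(1) carrier by (rule bouquet_map_eq_mult) (use that AB lift_in_kernel_iff in auto)
  have ker: "bij_betw ?F (mat_kernel ?AB) (mat_kernel A)"
    using lift_bij_kernel F by (subst bij_betw_cong[of _ _ "(*\<^sub>v) ?C"]) (auto simp: AB)
  have gr: "bij_betw ?F (graver_basis ?AB) (graver_basis A)"
    using lift_bij_graver F
    by (subst bij_betw_cong[of _ _ "(*\<^sub>v) ?C"]) (auto simp: AB graver_basis_def)
  have ci: "bij_betw ?F (matrix_circuits ?AB) (matrix_circuits A)"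
    using lift_bij_circuits F
    by (subst bij_betw_cong[of _ _ "(*\<^sub>v) ?C"]) (auto simp: AB matrix_circuits_def)
  show ?thesis using ker gr ci by (auto simp: bij_betw_def)
qed

end
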